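(* Let $\eta\in\{1,\dots,\mathsf M-1\}$ be such that $\mathsf M/\eta$ is a positive integer. The $(\mathsf M,n)$ partition Scheme A, using as subscheme the $(\mathsf M/\eta,n)$ Scheme A with $S_1,\dots,S_{\mathsf M/\eta-1}$ i.i.d. uniform on $\{0,\dots,n-1\}$, achieves rate, upload cost, access complexity and leakages $$\mathsf R_{\mathsf A,\mathsf P}=\Bigl(1+\frac1n+\dots+\frac1{n^{\mathsf M/\eta-1}}\Bigr)^{-1},\qquad \mathsf U_{\mathsf A,\mathsf P}=n\Bigl[\Bigl(\frac{\mathsf M}{\eta}-1\Bigr)\log_2n+\log_2\eta\Bigr]-\frac{\log_2\eta}{n^{\mathsf M/\eta-1}},$$ $$\Delta_{\mathsf A,\mathsf P}=(n-1)\frac{\mathsf M}{\eta},\qquad \rho^{(\mathsf{MI})}_{\mathsf A,\mathsf P}=\log_2\eta-\frac{\log_2\eta}{n^{\mathsf M/\eta}},\qquad \rho^{(\mathsf{WIL})}_{\mathsf A,\mathsf P}=\rho^{(\mathsf{MaxL})}_{\mathsf A,\mathsf P}=\log_2\eta .$$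
   Context: Entropies in bits. $n\ge2$ noncolluding servers each store the same $\mathsf M$ independent files $X^{(m)}=(X^{(m)}_1,\dots,X^{(m)}_\beta)$, uniform on $\{0,1\}^\beta$ with $\beta=n-1$; put $X^{(m)}_0:=0$. The requested index $M$ is uniform on $\{1,\dots,\mathsf M\}$, independent of the files. Partition Scheme A: write $k=\mathsf M/\eta$. Partition $j\in\{1,\dots,\eta\}$ contains the files with indices $(j-1)k+1,\dots,jk$. The user draws $S=(S_1,\dots,S_{k-1})\in\{0,\dots,n-1\}^{k-1}$ independently of $M$ and the files. If $M=m=(j-1)k+m'$ with $m'\in\{1,\dots,k\}$ and $S=s$, the query to server $l\in\{1,\dots,n\}$ is the length-$\mathsf M$ vector $$q_l=\bigl(0_{1\times(j-1)k},\,s_1,\dots,s_{m'-1},\,q_{l,m},\,s_{m'},\dots,s_{k-1},\,0_{1\times(\eta-j)k}\bigr),\qquad q_{l,m}=\Bigl(l-1-\sum_{i=1}^{k-1}s_i\Bigr)\bmod n,$$ with $q_{l,m}$ in position $m$. Server $l$ answers $A_l=X^{(1)}_{q_{l,1}}+\dots+X^{(\mathsf M)}_{q_{l,\mathsf M}}$ (mod 2). The answer length is $\ell_l(q_l)=0$ if $q_l=0$ and $1$ otherwise; the number of accessed symbols $\delta_l(q_l)$ is the number of nonzero entries of $q_l$. $Q_l$ denotes the random query. Quantities: rate $\mathsf R=\beta/\sum_l\mathbb E[\ell_l(Q_l)]$; upload cost $\mathsf U=\sum_l H(Q_l)$; access complexity $\Delta=\sum_l\mathbb E[\delta_l(Q_l)]$.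 Leakages: $\rho^{(\mathsf{MI})}=\frac1n\sum_l I(M;Q_l)$; $\rho^{(\mathsf{WIL})}=\max_l[H(M)-\min_qH(M\mid Q_l=q)]$ (min over $q$ with $P_{Q_l}(q)>0$); $\rho^{(\mathsf{MaxL})}=\max_l\log_2\sum_q\max_mP_{Q_l|M}(q|m)$. *)

theory Defs
  imports "HOL-Probability.Probability" "HOL-Library.Z2"
begin

text \<open>All random variables below take values in countable types and have finite range on the support
  of the underlying distribution, so counting measure on the whole type is the reference measure.\<close>

definition Hbits :: "'w pmf \<Rightarrow> ('w \<Rightarrow> 'x) \<Rightarrow> real" where
  "Hbits p X = prob_space.entropy (measure_pmf p) 2 (count_space UNIV) X"

definition Ibits :: "'w pmf \<Rightarrow> ('w \<Rightarrow> 'x) \<Rightarrow> ('w \<Rightarrow> 'y) \<Rightarrow> real" where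
  "Ibits p X Y =
     prob_space.mutual_information (measure_pmf p) 2 (count_space UNIV) (count_space UNIV) X Y"

text \<open>\<open>H(X | Y = y)\<close> for one value \<open>y\<close> of positive probability.\<close>

definition Hbits_given :: "'w pmf \<Rightarrow> ('w \<Rightarrow> 'x) \<Rightarrow> ('w \<Rightarrow> 'y) \<Rightarrow> 'y \<Rightarrow> real" where
  "Hbits_given p X Y y = Hbits (cond_pmf p {\<omega>. Y \<omega> = y}) X"

text \<open>A file is a function on symbol positions, and files are indexed from \<open>1\<close>; a query is a list
  whose entry for file \<open>i\<close> sits at list position \<open>i - 1\<close>.\<close>

type_synonym bitfile = "nat \<Rightarrow> bit"
type_synonym query = "nat list"

definition answer :: "(nat \<Rightarrow> bitfile) \<Rightarrow> query \<Rightarrow> bit" where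
  "answer X q = (\<Sum>i = 1..length q. X i (q ! (i - 1)))"

definition answer_length :: "query \<Rightarrow> nat" where
  "answer_length q = (if \<forall>x\<in>set q. x = 0 then 0 else 1)"

definition accessed :: "query \<Rightarrow> nat" where
  "accessed q = card {i. i < length q \<and> q ! i \<noteq> 0}"

text \<open>The bit string actually downloaded has exactly the length that the rate counts.\<close>

definition download :: "(nat \<Rightarrow> bitfile) \<Rightarrow> query \<Rightarrow> bit list" where
  "download X q = take (answer_length q) [answer X q]"

text \<open>Here \<open>n\<close> is the number of servers, \<open>Q l \<omega>\<close> the query sent to server \<open>l\<close>, \<open>M \<omega>\<close> the requested
  index and \<open>X \<omega>\<close> the stored files, for an outcome \<open>\<omega>\<close> of the common distribution \<open>p\<close>.\<close>

definition retrievable ::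
  "'w pmf \<Rightarrow> nat \<Rightarrow> ('w \<Rightarrow> nat) \<Rightarrow> ('w \<Rightarrow> nat \<Rightarrow> bitfile) \<Rightarrow> (nat \<Rightarrow> 'w \<Rightarrow> query) \<Rightarrow> bool" where
  "retrievable p n M X Q \<longleftrightarrow>
     (\<exists>dec :: nat \<Rightarrow> query list \<Rightarrow> bit list list \<Rightarrow> bitfile. \<forall>\<omega>\<in>set_pmf p.
        dec (M \<omega>) (map (\<lambda>l. Q l \<omega>) [1..<n+1]) (map (\<lambda>l. download (X \<omega>) (Q l \<omega>)) [1..<n+1])
          = X \<omega> (M \<omega>))"

definition rate :: "'w pmf \<Rightarrow> nat \<Rightarrow> nat \<Rightarrow> (nat \<Rightarrow> 'w \<Rightarrow> query) \<Rightarrow> real" where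
  "rate p n \<beta> Q =
     real \<beta> / (\<Sum>l = 1..n. measure_pmf.expectation p (\<lambda>\<omega>. real (answer_length (Q l \<omega>))))"

definition upload_cost :: "'w pmf \<Rightarrow> nat \<Rightarrow> (nat \<Rightarrow> 'w \<Rightarrow> query) \<Rightarrow> real" where
  "upload_cost p n Q = (\<Sum>l = 1..n. Hbits p (Q l))"

definition access_complexity :: "'w pmf \<Rightarrow> nat \<Rightarrow> (nat \<Rightarrow> 'w \<Rightarrow> query) \<Rightarrow> real" where
  "access_complexity p n Q =
     (\<Sum>l = 1..n. measure_pmf.expectation p (\<lambda>\<omega>. real (accessed (Q l \<omega>))))"

definition leakage_MI :: "'w pmf \<Rightarrow> nat \<Rightarrow> ('w \<Rightarrow> nat) \<Rightarrow> (nat \<Rightarrow> 'w \<Rightarrow> query) \<Rightarrow> real" where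
  "leakage_MI p n M Q = (1 / real n) * (\<Sum>l = 1..n. Ibits p M (Q l))"

definition leakage_WIL :: "'w pmf \<Rightarrow> nat \<Rightarrow> ('w \<Rightarrow> nat) \<Rightarrow> (nat \<Rightarrow> 'w \<Rightarrow> query) \<Rightarrow> real" where
  "leakage_WIL p n M Q =
     (MAX l\<in>{1..n}. Hbits p M - (MIN q\<in>Q l ` set_pmf p. Hbits_given p M (Q l) q))"

definition leakage_MaxL :: "'w pmf \<Rightarrow> nat \<Rightarrow> ('w \<Rightarrow> nat) \<Rightarrow> (nat \<Rightarrow> 'w \<Rightarrow> query) \<Rightarrow> real" where
  "leakage_MaxL p n M Q =
     (MAX l\<in>{1..n}. log 2 (\<Sum>q\<in>Q l ` set_pmf p. MAX m\<in>M ` set_pmf p.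
        \<P>(\<omega> in measure_pmf p. Q l \<omega> = q \<bar> M \<omega> = m)))"

text \<open>\<open>schemeA_query n m s l\<close> is the query of Scheme A on \<open>length s + 1\<close> files to server \<open>l\<close>.\<close>

definition schemeA_query :: "nat \<Rightarrow> nat \<Rightarrow> nat list \<Rightarrow> nat \<Rightarrow> query" where
  "schemeA_query n m s l =
     take (m - 1) s @ [nat ((int l - 1 - int (sum_list s)) mod int n)] @ drop (m - 1) s"

text \<open>\<open>\<mu>\<close> files in \<open>\<eta>\<close> partitions: \<open>m = (j - 1) * k + m'\<close> with \<open>1 \<le> m' \<le> k = \<mu> div \<eta>\<close>.\<close>

definition partitionA_query :: "nat \<Rightarrow> nat \<Rightarrow> nat \<Rightarrow> nat \<Rightarrow> nat list \<Rightarrow> nat \<Rightarrow> query" where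
  "partitionA_query n \<mu> \<eta> m s l =
     (let k = \<mu> div \<eta>;
          j = (m - 1) div k + 1;
          m' = (m - 1) mod k + 1
      in replicate ((j - 1) * k) 0 @ schemeA_query n m' s l @ replicate ((\<eta> - j) * k) 0)"

text \<open>A file of \<open>\<beta>\<close> uniform bits at positions \<open>1, \<dots>, \<beta>\<close>. All other positions are \<open>0\<close>; at position
  \<open>0\<close> this is the dummy symbol that a zero query entry refers to.\<close>

definition file_pmf :: "nat \<Rightarrow> bitfile pmf" where
  "file_pmf \<beta> = pmf_of_set (PiE_dflt {1..\<beta>} 0 (\<lambda>_. {0, 1}))"

type_synonym outcome = "nat \<times> nat list \<times> (nat \<Rightarrow> bitfile)"

definition requested :: "outcome \<Rightarrow> nat" where "requested = (\<lambda>(m, s, X). m)"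
definition randomness :: "outcome \<Rightarrow> nat list" where "randomness = (\<lambda>(m, s, X). s)"
definition stored :: "outcome \<Rightarrow> nat \<Rightarrow> bitfile" where "stored = (\<lambda>(m, s, X). X)"

text \<open>Joint law of the index, the \<open>\<mu> div \<eta> - 1\<close> i.i.d. uniform symbols \<open>S\<close> and the files, mutually
  independent.\<close>

definition partitionA_pmf :: "nat \<Rightarrow> nat \<Rightarrow> nat \<Rightarrow> outcome pmf" where
  "partitionA_pmf n \<mu> \<eta> =
     pair_pmf (pmf_of_set {1..\<mu>})
       (pair_pmf (replicate_pmf (\<mu> div \<eta> - 1) (pmf_of_set {0..n-1}))
         (Pi_pmf {1..\<mu>} (\<lambda>_. 0) (\<lambda>_. file_pmf (n - 1))))"

definition partitionA_Q :: "nat \<Rightarrow> nat \<Rightarrow> nat \<Rightarrow> nat \<Rightarrow> outcome \<Rightarrow> query" where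
  "partitionA_Q n \<mu> \<eta> l \<omega> = partitionA_query n \<mu> \<eta> (requested \<omega>) (randomness \<omega>) l"

end

theory Submission
  imports Defs
begin

text \<open>For a fixed requested index and server, the query determines the user's randomness, and its
  entries in the requested partition range over all words with a prescribed sum mod \<open>n\<close>. Queries from
  different partitions have disjoint supports, so they agree only when both are zero, which happens
  only at server \<open>1\<close>. Hence the pair (index, randomness) is uniform, and the fibre of the query over it
  has \<open>\<mu> div \<eta>\<close> elements, one for each index of the partition, except for the zero query, whose
  fibre has \<open>\<mu>\<close> elements. All entropies and leakages are functions of these fibre sizes.\<close>

section \<open>Entropies of finitely supported random variables\<close>

text \<open>Why server 1 is exceptional: inside the requested partition the entries of a query sum
  to l - 1 modulo n, so a zero word forces l = 1. With k files per partition, exactly one of the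
  n^(k-1) seeds produces it, and this single event accounts for every correction term. It saves one
  bit of download, so the expected total is n - 1/n^(k-1). It enlarges the fibre from k to \<eta> k,
  which lowers the entropy of that one query by log \<eta> / n^(k-1); the mean over n servers then
  has n^k in the denominator. The two worst-case leakages are decided by queries without collisions,
  so no correction survives in them. The access complexity is not a fibre count: it becomes easy
  once the sum over servers is taken first, because for a fixed seed the symbol at the requested
  position runs through every residue once.\<close>

lemma distributed_map_pmf:
  "distributed (measure_pmf p) (count_space UNIV) X (pmf (map_pmf X p))"
  unfolding distributed_def
  by (auto simp: map_pmf_rep_eq[symmetric] measure_pmf_eq_density[of "map_pmf X p", symmetric])

lemma integrable_count_space_finite_support:
  fixes f :: "'a \<Rightarrow> real"
  assumes "finite A" and "\<And>x. x \<notin> A \<Longrightarrow> f x = 0"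
  shows "integrable (count_space UNIV) f"
proof -
  have "integrable (count_space UNIV) (\<lambda>x. \<Sum>a\<in>A. f a * indicator {a} x)"
    by (intro Bochner_Integration.integrable_sum integrable_mult_right integrable_real_indicator)
       auto
  also have "(\<lambda>x. \<Sum>a\<in>A. f a * indicator {a} x) = f"
  proof
    fix x
    show "(\<Sum>a\<in>A. f a * indicator {a} x) = f x"
      using assms by (cases "x \<in> A") (auto simp: indicator_def if_distrib cong: if_cong)
  qed
  finally show ?thesis .
qed

lemma information_space_measure_pmf: "information_space (measure_pmf p) 2"
  by unfold_locales simp

lemma Hbits_cong_map_pmf:
  assumes "map_pmf X p = map_pmf Y q"
  shows "Hbits p X = Hbits q Y"
  unfolding Hbits_def prob_space.entropy_def[OF prob_space_measure_pmf] map_pmf_rep_eq[symmetric] assms ..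

lemma Hbits_eq_sum:
  assumes "finite (X ` set_pmf p)"
  shows "Hbits p X = - (\<Sum>x\<in>X ` set_pmf p. pmf (map_pmf X p) x * log 2 (pmf (map_pmf X p) x))"
proof -
  interpret information_space "measure_pmf p" 2 by (rule information_space_measure_pmf)
  show ?thesis
    unfolding Hbits_def
    by (subst entropy_distr[OF distributed_map_pmf], simp)
       (subst lebesgue_integral_count_space_finite_support,
        auto intro!: sum.mono_neutral_left finite_subset[OF _ assms] simp: assms set_pmf_iff[symmetric]
          pmf_eq_0_set_pmf)
qed

lemma Ibits_eq_Hbits:
  fixes X :: "'w \<Rightarrow> 'x::countable" and Y :: "'w \<Rightarrow> 'y::countable"
  assumes "finite (X ` set_pmf p)" and "finite (Y ` set_pmf p)"
  shows "Ibits p X Y = Hbits p X + Hbits p Y - Hbits p (\<lambda>\<omega>. (X \<omega>, Y \<omega>))"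
proof -
  interpret information_space "measure_pmf p" 2 by (rule information_space_measure_pmf)
  \<comment> \<open>\<open>Ibits\<close> refers to a product of two counting measures, the joint
    entropy to the counting measure on pairs; countability identifies them.\<close>
  have prod: "count_space UNIV \<Otimes>\<^sub>M count_space UNIV = count_space (UNIV :: ('x \<times> 'y) set)"
    by (subst pair_measure_countable) auto
  let ?Pxy = "pmf (map_pmf (\<lambda>\<omega>. (X \<omega>, Y \<omega>)) p)"
  have int: "integrable (count_space UNIV) (\<lambda>z. ?Pxy z * f z)" for f
    by (rule integrable_count_space_finite_support[where A = "X ` set_pmf p \<times> Y ` set_pmf p"])
       (use assms in \<open>auto simp: pmf_eq_0_set_pmf\<close>)
  show ?thesis
    unfolding Ibits_def Hbits_def prod[symmetric]
    by (rule mutual_information_eq_entropy_conditional_entropy_distr[where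
          Px = "pmf (map_pmf X p)" and Py = "pmf (map_pmf Y p)" and Pxy = ?Pxy])
       (auto simp: prod int intro!: distributed_map_pmf sigma_finite_measure_count_space)
qed

text \<open>Entropy is the mean of minus the log-probability of \<open>g d\<close> over uniform
  \<open>d\<close>, and that probability is the fibre size divided by \<open>card D\<close>.\<close>

lemma Hbits_pmf_of_set:
  assumes "finite D" and "D \<noteq> {}"
  shows "Hbits (pmf_of_set D) g
    = log 2 (card D) - (\<Sum>d\<in>D. log 2 (card {e\<in>D. g e = g d})) / card D"
proof -
  have pm: "pmf (map_pmf g (pmf_of_set D)) x = card {e\<in>D. g e = x} / card D" for x
    using assms by (simp add: pmf_map measure_pmf_of_set vimage_def Int_def)
  have pos: "card {e\<in>D. g e = g d} > 0" if "d \<in> D" for d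
    using assms that by (auto simp: card_gt_0_iff)
  have cD: "card D > 0" using assms by (simp add: card_gt_0_iff)
  let ?P = "\<lambda>x. real (card {e\<in>D. g e = x}) / card D"
  \<comment> \<open>The term of each value is divided equally among its preimages, which turns a sum
    over values into a sum over \<open>D\<close>.\<close>
  have "(\<Sum>x\<in>g ` D. ?P x * log 2 (?P x)) = (\<Sum>x\<in>g ` D. \<Sum>d\<in>{d\<in>D. g d = x}. log 2 (?P (g d)) / card D)"
    by (intro sum.cong) auto
  also have "\<dots> = (\<Sum>d\<in>D. log 2 (?P (g d)) / card D)"
    using assms(1) by (rule sum.image_gen[symmetric])
  also have "\<dots> = (\<Sum>d\<in>D. (log 2 (card {e\<in>D. g e = g d}) - log 2 (card D)) / card D)"
    using pos cD by (intro sum.cong) (auto simp: log_divide)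
  also have "\<dots> = (\<Sum>d\<in>D. log 2 (card {e\<in>D. g e = g d})) / card D - log 2 (card D)"
    using cD by (simp add: sum_divide_distrib[symmetric] sum_subtractf field_simps)
  finally show ?thesis
    using assms by (simp add: Hbits_eq_sum pm)
qed

lemma Hbits_pmf_of_set_inj:
  assumes "finite D" and "D \<noteq> {}" and "inj_on g D"
  shows "Hbits (pmf_of_set D) g = log 2 (card D)"
proof -
  have "{e\<in>D. g e = g d} = {d}" if "d \<in> D" for d
    using assms(3) that by (auto dest: inj_onD)
  then show ?thesis using assms(1,2) by (simp add: Hbits_pmf_of_set)
qed

lemma cond_pmf_of_set:
  assumes "finite D" and "D \<inter> S \<noteq> {}"
  shows "cond_pmf (pmf_of_set D) S = pmf_of_set (D \<inter> S)"
proof -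
  have "D \<noteq> {}" "card D > 0" "card (D \<inter> S) > 0" using assms by (auto simp: card_gt_0_iff)
  then show ?thesis
    using assms by (intro pmf_eqI) (auto simp: pmf_cond measure_pmf_of_set indicator_def)
qed

lemma pair_pmf_of_set:
  assumes "finite A" and "A \<noteq> {}" and "finite B" and "B \<noteq> {}"
  shows "pair_pmf (pmf_of_set A) (pmf_of_set B) = pmf_of_set (A \<times> B)"
proof (rule pmf_eqI)
  fix x :: "'a \<times> 'b"
  have "A \<times> B \<noteq> {}" "finite (A \<times> B)" using assms by auto
  then show "pmf (pair_pmf (pmf_of_set A) (pmf_of_set B)) x = pmf (pmf_of_set (A \<times> B)) x"
    using assms by (cases x) (simp add: pmf_pair card_cartesian_product indicator_def)
qed

lemma replicate_pmf_of_set: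
  assumes "finite A" and "A \<noteq> {}"
  shows "replicate_pmf r (pmf_of_set A) = pmf_of_set {xs. set xs \<subseteq> A \<and> length xs = r}"
proof (induction r)
  case 0
  have "{xs. set xs \<subseteq> A \<and> length xs = 0} = {[]}" by auto
  then show ?case by (simp add: pmf_of_set_singleton)
next
  case (Suc r)
  let ?L = "{xs. set xs \<subseteq> A \<and> length xs = r}"
  have L: "finite ?L" "?L \<noteq> {}"
    using assms by (auto simp: finite_lists_length_eq intro!: exI[of _ "replicate r (SOME a. a \<in> A)"]
      dest: in_set_replicate[THEN iffD1] simp: some_in_eq)
  have "replicate_pmf (Suc r) (pmf_of_set A)
      = map_pmf (\<lambda>(x, xs). x # xs) (pair_pmf (pmf_of_set A) (pmf_of_set ?L))"
    by (simp add: Suc pair_pmf_def map_bind_pmf)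
  also have "pair_pmf (pmf_of_set A) (pmf_of_set ?L) = pmf_of_set (A \<times> ?L)"
    using assms L by (rule pair_pmf_of_set)
  also have "map_pmf (\<lambda>(x, xs). x # xs) \<dots> = pmf_of_set ((\<lambda>(x, xs). x # xs) ` (A \<times> ?L))"
    using assms L by (intro map_pmf_of_set_inj) (auto simp: inj_on_def)
  also have "(\<lambda>(x, xs). x # xs) ` (A \<times> ?L) = {xs. set xs \<subseteq> A \<and> length xs = Suc r}"
    by (auto simp: image_iff length_Suc_conv)
  finally show ?case .
qed

section \<open>Queries of the partition scheme\<close>

text \<open>The query entry at the requested position: the unique residue that completes the seed to
  a word with sum l - 1 modulo \<open>n\<close>.\<close>

definition balancing_symbol :: "nat \<Rightarrow> nat list \<Rightarrow> nat \<Rightarrow> nat" where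
  "balancing_symbol n s l = nat ((int l - 1 - int (sum_list s)) mod int n)"

lemma schemeA_query_eq:
  "schemeA_query n m s l = take (m - 1) s @ balancing_symbol n s l # drop (m - 1) s"
  by (simp add: schemeA_query_def balancing_symbol_def)

lemma int_balancing_symbol:
  assumes "n > 0"
  shows "int (balancing_symbol n s l) = (int l - 1 - int (sum_list s)) mod int n"
  using assms by (simp add: balancing_symbol_def)

lemma balancing_symbol_less: "n > 0 \<Longrightarrow> balancing_symbol n s l < n"
  using int_balancing_symbol[of n s l] by (metis of_nat_0_less_iff of_nat_less_iff pos_mod_bound)

lemma balancing_symbol_eqI:
  assumes "a < n" and "int (a + sum_list s) mod int n = (int l - 1) mod int n"
  shows "balancing_symbol n s l = a"
proof -
  have "(int l - 1 - int (sum_list s)) mod int n = (int (a + sum_list s) - int (sum_list s)) mod int n"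
    using assms(2) by (metis mod_diff_left_eq)
  also have "\<dots> = int a" using assms(1) by simp
  finally show ?thesis by (simp add: balancing_symbol_def)
qed

lemma balancing_symbol_sum:
  assumes "n > 0"
  shows "int (balancing_symbol n s l + sum_list s) mod int n = (int l - 1) mod int n"
  using assms by (simp add: int_balancing_symbol mod_simps)

text \<open>For a fixed seed the symbol reveals l - 1 modulo \<open>n\<close>, hence
  \<open>l\<close>; injectivity and counting do the rest. Decoding uses the surjectivity, the access
  count the whole bijection.\<close>

lemma bij_betw_balancing_symbol:
  assumes "n > 0"
  shows "bij_betw (balancing_symbol n s) {1..n} {0..<n}"
proof (rule bij_betw_imageI)
  show inj: "inj_on (balancing_symbol n s) {1..n}"
  proof (rule inj_onI)
    fix l l' assume l: "l \<in> {1..n}" "l' \<in> {1..n}"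
      and eq: "balancing_symbol n s l = balancing_symbol n s l'"
    have "(int l - 1) mod int n = (int l' - 1) mod int n"
      using balancing_symbol_sum[OF assms, of s l] balancing_symbol_sum[OF assms, of s l'] eq by simp
    then show "l = l'" using l by simp
  qed
  show "balancing_symbol n s ` {1..n} = {0..<n}"
    using inj by (intro card_subset_eq) (auto simp: balancing_symbol_less assms card_image)
qed

text \<open>The number of files is represented as \<open>\<eta> * k\<close>, which builds in
  divisibility and makes \<open>k\<close> the partition size.\<close>

locale partition_scheme =
  fixes n k \<eta> :: nat
  assumes n_ge_2: "n \<ge> 2" and k_pos: "k > 0" and eta_pos: "\<eta> > 0"
begin

definition seeds :: "nat list set" where
  "seeds = {s. set s \<subseteq> {0..n-1} \<and> length s = k - 1}"

abbreviation query_to :: "nat \<Rightarrow> nat \<times> nat list \<Rightarrow> query" where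
  "query_to l \<equiv> \<lambda>(m, s). partitionA_query n (\<eta> * k) \<eta> m s l"

abbreviation zero_seed :: "nat list" where
  "zero_seed \<equiv> replicate (k - 1) 0"

text \<open>Partitions are numbered from 0 here, so \<open>b\<close> is j - 1 and
  \<open>\<eta> - Suc b\<close> partitions follow.\<close>

definition embed :: "nat \<Rightarrow> nat list \<Rightarrow> query" where
  "embed b w = replicate (b * k) 0 @ w @ replicate ((\<eta> - Suc b) * k) 0"

definition block :: "nat \<Rightarrow> nat" where
  "block m = (m - 1) div k"

lemma query_to_eq:
  "query_to l (m, s) = embed (block m) (schemeA_query n ((m - 1) mod k + 1) s l)"
  using eta_pos by (simp add: partitionA_query_def embed_def block_def Let_def)

lemma block_less: "m \<in> {1..\<eta> * k} \<Longrightarrow> block m < \<eta>"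
  unfolding block_def by (subst div_less_iff_less_mult) (use k_pos in auto)

lemma finite_seeds [simp]: "finite seeds"
  unfolding seeds_def by (rule finite_lists_length_eq) simp

lemma card_seeds: "card seeds = n ^ (k - 1)"
  using n_ge_2 unfolding seeds_def by (subst card_lists_length_eq) auto

lemma zero_seed_in_seeds [simp]: "replicate (k - Suc 0) 0 \<in> seeds"
  by (auto simp: seeds_def)

lemma length_schemeA_query: "s \<in> seeds \<Longrightarrow> length (schemeA_query n m s l) = k"
  using k_pos by (auto simp: schemeA_query_eq seeds_def)

text \<open>The only candidate seed is \<open>w\<close> with entry \<open>m\<close> deleted, and the
  congruence says exactly that the deleted entry balances the rest. The conditions on
  \<open>w\<close> do not mention \<open>m\<close>, so all indices of a partition generate the same
  words.\<close>

lemma ex1_schemeA_query_eq: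
  assumes w: "length w = k" "set w \<subseteq> {0..n-1}" "int (sum_list w) mod int n = (int l - 1) mod int n"
    and m: "m \<in> {1..k}"
  shows "\<exists>!s. s \<in> seeds \<and> schemeA_query n m s l = w"
proof (rule ex1I)
  let ?s = "take (m - 1) w @ drop m w"
  have m': "Suc (m - 1) = m" "m - 1 < length w" using w(1) m by auto
  have split: "w = take (m - 1) w @ w ! (m - 1) # drop m w"
    using id_take_nth_drop[OF m'(2)] unfolding m'(1) .
  have "int (w ! (m - 1) + sum_list ?s) = int (sum_list w)"
    \<comment> \<open>The fourth occurrence of \<open>w\<close> is the one on the right-hand side;
      only that one is to be taken apart.\<close>
    by (subst (4) split) simp
  moreover have "w ! (m - 1) < n"
    using subsetD[OF w(2) nth_mem[OF m'(2)]] n_ge_2 by simp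
  ultimately have "balancing_symbol n ?s l = w ! (m - 1)"
    using w(3) by (intro balancing_symbol_eqI) (simp_all only:)
  moreover have "take (m - 1) ?s = take (m - 1) w" "drop (m - 1) ?s = drop m w"
    using m'(2) by simp_all
  ultimately have "schemeA_query n m ?s l = w"
    by (simp only: schemeA_query_eq split[symmetric])
  moreover have "?s \<in> seeds"
    using w m by (auto simp: seeds_def dest!: in_set_takeD in_set_dropD)
  ultimately show "?s \<in> seeds \<and> schemeA_query n m ?s l = w" by simp
next
  fix s assume s: "s \<in> seeds \<and> schemeA_query n m s l = w"
  then have "length s = k - 1" by (simp add: seeds_def)
  then have "take (m - 1) w = take (m - 1) s" "drop m w = drop (m - 1) s"
    using s m by (auto simp: schemeA_query_eq min_def)
  then show "s = take (m - 1) w @ drop m w" by simp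
qed

lemma schemeA_query_properties:
  assumes "s \<in> seeds"
  shows "set (schemeA_query n m s l) \<subseteq> {0..n-1}"
    and "int (sum_list (schemeA_query n m s l)) mod int n = (int l - 1) mod int n"
proof -
  have "set (take (m - 1) s) \<union> set (drop (m - 1) s) = set s"
    by (metis append_take_drop_id set_append)
  moreover have "balancing_symbol n s l \<le> n - 1"
    using balancing_symbol_less[of n s l] n_ge_2 by simp
  ultimately show "set (schemeA_query n m s l) \<subseteq> {0..n-1}"
    using assms by (auto simp: schemeA_query_eq seeds_def)
  have "sum_list (take (m - 1) s) + sum_list (drop (m - 1) s) = sum_list s"
    by (metis append_take_drop_id sum_list_append)
  then have "sum_list (schemeA_query n m s l) = balancing_symbol n s l + sum_list s"
    by (simp add: schemeA_query_eq)
  then show "int (sum_list (schemeA_query n m s l)) mod int n = (int l - 1) mod int n"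
    using balancing_symbol_sum[of n s l] n_ge_2 by simp
qed

text \<open>The word contains the whole seed, and its sum 0 has residue l - 1, which for
  \<open>l\<close> up to \<open>n\<close> leaves only server 1.\<close>

lemma schemeA_query_zero_iff:
  assumes "s \<in> seeds" and "l \<in> {1..n}"
  shows "(\<forall>x\<in>set (schemeA_query n m s l). x = 0) \<longleftrightarrow> l = 1 \<and> s = zero_seed"
proof
  assume z: "\<forall>x\<in>set (schemeA_query n m s l). x = 0"
  have "set s \<subseteq> set (schemeA_query n m s l)"
    unfolding schemeA_query_eq
    by (subst append_take_drop_id[of "m - 1" s, symmetric]) (auto simp del: append_take_drop_id)
  then have "\<forall>x\<in>set s. x = 0" using z by auto
  then have s: "s = zero_seed"
    using assms(1) by (auto simp: seeds_def intro!: replicate_eqI)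
  have "sum_list (schemeA_query n m s l) = 0"
    unfolding sum_list_eq_0_iff by (rule z)
  then have "(int l - 1) mod int n = 0"
    using schemeA_query_properties(2)[OF assms(1), of m l] by (metis mod_0 of_nat_0)
  then have "l = 1" using assms(2) by simp
  with s show "l = 1 \<and> s = zero_seed" by simp
next
  assume "l = 1 \<and> s = zero_seed"
  then show "\<forall>x\<in>set (schemeA_query n m s l). x = 0"
    by (auto simp: schemeA_query_eq balancing_symbol_def sum_list_replicate dest: in_set_takeD in_set_dropD)
qed

lemma query_to_zero_iff:
  assumes "s \<in> seeds" and "l \<in> {1..n}"
  shows "(\<forall>x\<in>set (query_to l (m, s)). x = 0) \<longleftrightarrow> l = 1 \<and> s = zero_seed"
  unfolding schemeA_query_zero_iff[OF assms, symmetric, of "(m - 1) mod k + 1"] query_to_eq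
  by (auto simp: embed_def)

section \<open>Collisions between queries of different partitions\<close>

text \<open>Reading a query block by block is what separates partitions: two queries placed in
  different blocks can agree only if both words vanish.\<close>

lemma slice_embed:
  assumes "length w = k" and "b < \<eta>" and "b' < \<eta>"
  shows "take k (drop (b' * k) (embed b w)) = (if b' = b then w else replicate k 0)"
proof -
  consider "b' = b" | "b' < b" | "b < b'" by linarith
  then show ?thesis
  proof cases
    case 1 then show ?thesis using assms by (simp add: embed_def)
  next
    case 2
    \<comment> \<open>\<open>d\<close> counts the blocks strictly between the two; the zeros in
      front of \<open>w\<close> are cut around block \<open>b'\<close>.\<close>
    then obtain d where d: "b = Suc b' + d" by (metis less_iff_Suc_add add_Suc)
    have "replicate (b * k) 0 = replicate (b' * k) 0 @ replicate k 0 @ replicate (d * k) (0::nat)"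
      by (simp add: d replicate_add[symmetric] algebra_simps)
    then show ?thesis using 2 by (simp add: embed_def)
  next
    case 3
    then obtain d where d: "b' = Suc b + d" by (metis less_iff_Suc_add add_Suc)
    then obtain e where e: "\<eta> = Suc b' + e" using assms by (metis less_iff_Suc_add add_Suc)
    have "replicate ((\<eta> - Suc b) * k) 0
        = replicate (d * k) 0 @ replicate k 0 @ replicate (e * k) (0::nat)"
      by (simp add: d e replicate_add[symmetric] algebra_simps)
    then have "embed b w = (replicate (b * k) 0 @ w @ replicate (d * k) 0) @ replicate k 0
        @ replicate (e * k) 0"
      by (simp add: embed_def)
    moreover have "b' * k = length (replicate (b * k) 0 @ w @ replicate (d * k) (0::nat))"
      by (simp add: d assms(1) algebra_simps)
    ultimately have "drop (b' * k) (embed b w) = replicate k 0 @ replicate (e * k) 0"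
      by (metis append_eq_conv_conj)
    then show ?thesis using 3 by simp
  qed
qed

text \<open>The basic count: summed over \<open>m'\<close> it gives the fibre size, at
  \<open>m' = m\<close> the injectivity of (index, query), and divided by the number of seeds the
  conditional probability of a query. Within a block the unique-seed lemma applies directly; across
  blocks it applies only to the zero word.\<close>

lemma card_seeds_query_to_eq:
  assumes m: "m \<in> {1..\<eta> * k}" "m' \<in> {1..\<eta> * k}" and s: "s \<in> seeds" and l: "l \<in> {1..n}"
  shows "card {s' \<in> seeds. query_to l (m', s') = query_to l (m, s)}
    = (if block m' = block m \<or> l = 1 \<and> s = zero_seed then 1 else 0)"
proof -
  define w where "w = schemeA_query n ((m - 1) mod k + 1) s l"
  define w' where "w' = (\<lambda>s'. schemeA_query n ((m' - 1) mod k + 1) s' l)"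
  have w: "length w = k" "set w \<subseteq> {0..n-1}" "int (sum_list w) mod int n = (int l - 1) mod int n"
    unfolding w_def using s by (rule length_schemeA_query schemeA_query_properties)+
  have "(\<forall>x\<in>set w. x = 0) \<longleftrightarrow> w = replicate k 0"
    using replicate_eqI[OF w(1)] by (metis in_set_replicate)
  then have zero: "(l = 1 \<and> s = zero_seed) \<longleftrightarrow> w = replicate k 0"
    unfolding w_def schemeA_query_zero_iff[OF s l] .
  have eq: "query_to l (m', s') = query_to l (m, s) \<longleftrightarrow>
      (block m' = block m \<or> w = replicate k 0) \<and> w' s' = w" if "s' \<in> seeds" for s'
  proof -
    have len: "length (w' s') = k" using that by (simp add: w'_def length_schemeA_query)
    show ?thesis
    proof (cases "block m' = block m")
      case True
      then show ?thesis unfolding query_to_eq w_def[symmetric] by (simp add: w'_def embed_def)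
    next
      case False
      \<comment> \<open>The embedded zero word does not remember its block, which is the only source
        of collisions.\<close>
      have emb0: "embed b (replicate k 0) = replicate (\<eta> * k) 0" if "b < \<eta>" for b
      proof -
        have "b + Suc (\<eta> - Suc b) = \<eta>" using that by simp
        then have "b * k + (k + (\<eta> - Suc b) * k) = \<eta> * k"
          by (metis add_mult_distrib mult_Suc)
        then show ?thesis by (simp add: embed_def replicate_add[symmetric])
      qed
      have b: "block m < \<eta>" "block m' < \<eta>" using m by (simp_all add: block_less)
      have "embed (block m') (w' s') = embed (block m) w
          \<longleftrightarrow> w = replicate k 0 \<and> w' s' = replicate k 0"
      proof
        assume e: "embed (block m') (w' s') = embed (block m) w"
        show "w = replicate k 0 \<and> w' s' = replicate k 0"
          \<comment> \<open>Reading block \<open>block m\<close> on both sides gives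
            \<open>w = replicate k 0\<close>; reading \<open>block m'\<close> gives the same for
            \<open>w' s'\<close>.\<close>
          using slice_embed[OF len b(2) b(1)] slice_embed[OF w(1) b(1) b(1)]
            slice_embed[OF len b(2) b(2)] slice_embed[OF w(1) b(1) b(2)]
          unfolding e if_not_P[OF False] if_not_P[OF False[symmetric]] by simp
      qed (simp add: emb0 b)
      then have "query_to l (m', s') = query_to l (m, s) \<longleftrightarrow> w = replicate k 0 \<and> w' s' = replicate k 0"
        unfolding query_to_eq w_def w'_def .
      then show ?thesis using False by auto
    qed
  qed
  have "\<exists>!s'. s' \<in> seeds \<and> w' s' = w"
    unfolding w'_def by (intro ex1_schemeA_query_eq w) (simp add: Suc_le_eq k_pos)
  then have "card {s' \<in> seeds. w' s' = w} = 1"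
    unfolding One_nat_def card_1_singleton_iff by blast
  moreover have "{s' \<in> seeds. query_to l (m', s') = query_to l (m, s)}
      = (if block m' = block m \<or> w = replicate k 0 then {s' \<in> seeds. w' s' = w} else {})"
    using eq by auto
  ultimately show ?thesis
    unfolding zero by (cases "block m' = block m \<or> w = replicate k 0") (simp_all only: if_True if_False card.empty)
qed

lemma card_block:
  assumes "m \<in> {1..\<eta> * k}"
  shows "card ({1..\<eta> * k} \<inter> {m'. block m' = block m}) = k"
proof -
  \<comment> \<open>The interval of the block stays inside the index range, so the intersection does
    not truncate it.\<close>
  have "block m * k + k \<le> \<eta> * k"
    using block_less[OF assms] by (metis Suc_leI add.commute mult_Suc mult_le_mono1)
  moreover have "block m' = block m \<longleftrightarrow> m' \<in> {block m * k + 1..block m * k + k}" if "m' \<ge> 1" for m'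
  proof -
    have "block m' = block m \<longleftrightarrow> block m * k \<le> m' - 1 \<and> m' - 1 < block m * k + k"
      unfolding block_def[of m'] using k_pos
      by (metis add.commute div_nat_eqI dividend_less_times_div less_eq_div_iff_mult_less_eq mult.commute mult_Suc order_refl)
    then show ?thesis using that by auto
  qed
  ultimately have "{1..\<eta> * k} \<inter> {m'. block m' = block m} = {block m * k + 1..block m * k + k}"
    by auto
  then show ?thesis by simp
qed

section \<open>Draws of index and seed, and their fibre sizes\<close>

definition draws :: "(nat \<times> nat list) set" where
  "draws = {1..\<eta> * k} \<times> seeds"

lemma draws_finite [simp]: "finite draws" and draws_nonempty [simp]: "draws \<noteq> {}"
  and card_draws: "card draws = \<eta> * k * n ^ (k - 1)"
proof -
  have "seeds \<noteq> {}" using zero_seed_in_seeds by blast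
  then show "finite draws" "draws \<noteq> {}" "card draws = \<eta> * k * n ^ (k - 1)"
    using eta_pos k_pos by (auto simp: draws_def card_cartesian_product card_seeds Suc_le_eq)
qed

lemma card_fibre:
  assumes "(m, s) \<in> draws" and l: "l \<in> {1..n}"
  shows "card {e \<in> draws. query_to l e = query_to l (m, s)}
    = (if l = 1 \<and> s = zero_seed then \<eta> * k else k)"
proof -
  have m: "m \<in> {1..\<eta> * k}" and s: "s \<in> seeds" using assms by (auto simp: draws_def)
  have fibre: "{e \<in> draws. query_to l e = query_to l (m, s)}
      = (SIGMA m' : {1..\<eta> * k}. {s' \<in> seeds. query_to l (m', s') = query_to l (m, s)})"
    by (auto simp: draws_def)
  have count: "card ({1..\<eta> * k} \<inter> {m'. block m' = block m \<or> Z}) = (if Z then \<eta> * k else k)" for Z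
    using card_block[OF m] by (cases Z) simp_all
  have "card {e \<in> draws. query_to l e = query_to l (m, s)}
      = (\<Sum>m' = 1..\<eta> * k. if block m' = block m \<or> l = 1 \<and> s = zero_seed then 1 else 0)"
    unfolding fibre using card_seeds_query_to_eq[OF m _ s l] by simp
  also have "\<dots> = card ({1..\<eta> * k} \<inter> {m'. block m' = block m \<or> l = 1 \<and> s = zero_seed})"
    by (simp add: sum.If_cases)
  also have "\<dots> = (if l = 1 \<and> s = zero_seed then \<eta> * k else k)"
    by (rule count)
  finally show ?thesis .
qed

lemma sum_seeds_zero_case:
  fixes a b :: real
  shows "(\<Sum>s\<in>seeds. if l = 1 \<and> s = zero_seed then a else b)
    = real (n ^ (k - 1)) * b + (if l = (1::nat) then a - b else 0)"
proof -
  have "(\<Sum>s\<in>seeds. if l = 1 \<and> s = zero_seed then a else b)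
      = (\<Sum>s\<in>seeds. b + (if s = zero_seed then (if l = 1 then a - b else 0) else 0))"
    by (intro sum.cong) auto
  then show ?thesis by (simp add: sum.distrib card_seeds)
qed

text \<open>Taken with the logarithm this yields the query entropy, with the reciprocal the number
  of distinct queries.\<close>

lemma sum_draws_fibre:
  fixes f :: "nat \<Rightarrow> real"
  assumes "l \<in> {1..n}"
  shows "(\<Sum>d\<in>draws. f (card {e \<in> draws. query_to l e = query_to l d}))
    = real (\<eta> * k) * (real (n ^ (k - 1)) * f k + (if l = 1 then f (\<eta> * k) - f k else 0))"
proof -
  have "(\<Sum>d\<in>draws. f (card {e \<in> draws. query_to l e = query_to l d}))
      = (\<Sum>(m, s)\<in>draws. if l = 1 \<and> s = zero_seed then f (\<eta> * k) else f k)"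
    using card_fibre[OF _ assms] by (intro sum.cong) (auto split: if_splits)
  also have "\<dots> = (\<Sum>m=1..\<eta> * k. \<Sum>s\<in>seeds. if l = 1 \<and> s = zero_seed then f (\<eta> * k) else f k)"
    unfolding draws_def by (rule sum.cartesian_product[symmetric])
  finally show ?thesis by (simp only: sum_seeds_zero_case) simp
qed

end

section \<open>Nonzero entries and downloaded symbols\<close>

text \<open>Each of the \<open>r\<close> positions is nonzero in a fraction (n - 1)/n of the words;
  the factor \<open>n\<close> on the left clears the denominator.\<close>

lemma sum_nonzero_entries:
  "real n * (\<Sum>s | set s \<subseteq> {0..n-1} \<and> length s = r. real (length (filter (\<lambda>x. x \<noteq> 0) s)))
    = real r * (real n - 1) * real n ^ r" if "n > 0"
proof (induction r)
  case 0
  have "{s. set s \<subseteq> {0..n-1} \<and> length s = 0} = {[]}" by auto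
  then show ?case by simp
next
  case (Suc r)
  let ?L = "{s. set s \<subseteq> {0..n-1} \<and> length s = r}"
  let ?nz = "\<lambda>s. real (length (filter (\<lambda>x::nat. x \<noteq> 0) s))"
  have card: "card ?L = n ^ r" using that by (subst card_lists_length_eq) auto
  have "{0..n-1} \<inter> {x. x \<noteq> 0} = {1..n-1}" by auto
  then have nz: "(\<Sum>x=0..n-1. if x \<noteq> 0 then 1 else 0 :: real) = real n - 1"
    using that by (simp add: sum.If_cases)
  have "(\<Sum>s | set s \<subseteq> {0..n-1} \<and> length s = Suc r. ?nz s)
      = (\<Sum>(s, x) \<in> ?L \<times> {0..n-1}. ?nz (x # s))"
    unfolding lists_length_Suc_eq by (subst sum.reindex) (auto simp: inj_on_def case_prod_unfold)
  also have "\<dots> = (\<Sum>s\<in>?L. \<Sum>x=0..n-1. ?nz s + (if x \<noteq> 0 then 1 else 0))"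
    unfolding sum.cartesian_product by (intro sum.cong) auto
  also have "\<dots> = (\<Sum>s\<in>?L. real n * ?nz s + (real n - 1))"
    unfolding sum.distrib nz using that by simp
  also have "\<dots> = real n * (\<Sum>s\<in>?L. ?nz s) + real n ^ r * (real n - 1)"
    by (simp add: sum.distrib sum_distrib_left card del: One_nat_def)
  finally show ?case by (simp only: distrib_left Suc.IH) (simp add: algebra_simps)
qed

lemma accessed_eq_length_filter: "accessed q = length (filter (\<lambda>x. x \<noteq> 0) q)"
  by (simp add: accessed_def length_filter_conv_card)

text \<open>Reading an empty download as 0 is correct because it comes only from a zero query, whose
  answer is a sum of dummy symbols.\<close>

definition downloaded_symbol :: "bit list \<Rightarrow> bit" where
  "downloaded_symbol d = (case d of [] \<Rightarrow> 0 | b # _ \<Rightarrow> b)"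

lemma downloaded_symbol_download:
  assumes "\<And>i. X i 0 = 0"
  shows "downloaded_symbol (download X q) = answer X q"
proof (cases "\<forall>x\<in>set q. x = 0")
  case True
  then have "X i (q ! (i - 1)) = 0" if "i \<in> {1..length q}" for i
  proof -
    have "q ! (i - 1) = 0" using that by (intro bspec[OF True] nth_mem) auto
    then show ?thesis using assms by simp
  qed
  then show ?thesis
    using True by (simp add: downloaded_symbol_def download_def answer_length_def answer_def)
qed (simp add: downloaded_symbol_def download_def answer_length_def)

text \<open>The remainder carries 0 in place of \<open>a\<close> so that it visibly does not depend
  on \<open>a\<close>: it is the interference that remains when only this entry varies.\<close>

lemma answer_append_Cons:
  "answer X (xs @ a # ys) = X (Suc (length xs)) a
    + (\<Sum>i\<in>{1..Suc (length xs + length ys)} - {Suc (length xs)}. X i ((xs @ 0 # ys) ! (i - 1)))"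
proof -
  have "X i ((xs @ a # ys) ! (i - 1)) = X i ((xs @ 0 # ys) ! (i - 1))"
    if "i \<in> {1..Suc (length xs + length ys)} - {Suc (length xs)}" for i
    using that by (auto simp: nth_append nth_Cons')
  then show ?thesis
    unfolding answer_def
    by (subst sum.remove[of _ "Suc (length xs)"]) (auto intro!: sum.cong)
qed

section \<open>Cost and leakage of the partition scheme\<close>

context partition_scheme
begin

abbreviation scheme_pmf :: "outcome pmf" where
  "scheme_pmf \<equiv> partitionA_pmf n (\<eta> * k) \<eta>"

abbreviation Q :: "nat \<Rightarrow> outcome \<Rightarrow> query" where
  "Q \<equiv> partitionA_Q n (\<eta> * k) \<eta>"

definition draw :: "outcome \<Rightarrow> nat \<times> nat list" where
  "draw \<omega> = (requested \<omega>, randomness \<omega>)"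

lemma Q_eq_query_to: "Q l \<omega> = query_to l (draw \<omega>)"
  by (simp add: partitionA_Q_def draw_def)

lemma fst_draw: "fst (draw \<omega>) = requested \<omega>"
  by (simp add: draw_def)

lemma scheme_pmf_eq:
  "scheme_pmf = pair_pmf (pmf_of_set {1..\<eta> * k})
    (pair_pmf (pmf_of_set seeds) (Pi_pmf {1..\<eta> * k} (\<lambda>_. 0) (\<lambda>_. file_pmf (n - 1))))"
  using eta_pos by (simp add: partitionA_pmf_def replicate_pmf_of_set seeds_def)

lemma seeds_nonempty [simp]: "seeds \<noteq> {}"
  using zero_seed_in_seeds by blast

lemma requests_nonempty [simp]: "{1..\<eta> * k} \<noteq> {}"
  using eta_pos k_pos by (simp add: Suc_le_eq)

text \<open>Marginalising the files leaves a uniform distribution, so statements about queries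
  reduce to counting in \<open>draws\<close>.\<close>

lemma map_draw: "map_pmf draw scheme_pmf = pmf_of_set draws"
proof -
  have draw: "draw = apsnd fst"
    by (auto simp: draw_def requested_def randomness_def)
  have "map_pmf draw scheme_pmf = pair_pmf (pmf_of_set {1..\<eta> * k}) (pmf_of_set seeds)"
    unfolding scheme_pmf_eq draw pair_map_pmf2[symmetric] map_fst_pair_pmf ..
  also have "\<dots> = pmf_of_set draws"
    unfolding draws_def
    by (rule pair_pmf_of_set[OF finite_atLeastAtMost requests_nonempty finite_seeds seeds_nonempty])
  finally show ?thesis .
qed

lemma map_pmf_draw: "map_pmf (\<lambda>\<omega>. f (draw \<omega>)) scheme_pmf = map_pmf f (pmf_of_set draws)"
  unfolding map_draw[symmetric] map_pmf_comp ..

lemma image_draw: "(\<lambda>\<omega>. f (draw \<omega>)) ` set_pmf scheme_pmf = f ` draws"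
  using arg_cong[OF map_pmf_draw[of f], of set_pmf] by simp

lemma expectation_draw:
  fixes f :: "nat \<times> nat list \<Rightarrow> real"
  shows "measure_pmf.expectation scheme_pmf (\<lambda>\<omega>. f (draw \<omega>)) = (\<Sum>d\<in>draws. f d) / card draws"
proof -
  have "measure_pmf.expectation scheme_pmf (\<lambda>\<omega>. f (draw \<omega>))
      = measure_pmf.expectation (map_pmf draw scheme_pmf) f" by simp
  then show ?thesis unfolding map_draw by (simp add: integral_pmf_of_set)
qed

lemma prob_draw:
  "measure_pmf.prob scheme_pmf {\<omega>. P (draw \<omega>)} = card {d \<in> draws. P d} / card draws"
proof -
  have "measure_pmf.prob scheme_pmf {\<omega>. P (draw \<omega>)} = measure_pmf.prob (map_pmf draw scheme_pmf) {d. P d}"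
    by (simp add: vimage_def)
  then show ?thesis unfolding map_draw by (simp add: measure_pmf_of_set Int_def)
qed

lemma inj_on_request_query:
  assumes "l \<in> {1..n}"
  shows "inj_on (\<lambda>d. (fst d, query_to l d)) draws"
proof (rule inj_onI)
  fix d e
  assume d: "d \<in> draws" and e: "e \<in> draws"
    and eq: "(fst d, query_to l d) = (fst e, query_to l e)"
  obtain m s s' where ds: "d = (m, s)" "e = (m, s')" using eq by (cases d, cases e) auto
  let ?F = "{t \<in> seeds. query_to l (m, t) = query_to l (m, s)}"
  have "card ?F = 1"
    using card_seeds_query_to_eq[of m m s l] d assms by (simp add: ds draws_def)
  then obtain t where t: "?F = {t}" by (rule card_1_singletonE)
  have "s \<in> seeds" "s' \<in> seeds" "query_to l (m, s') = query_to l (m, s)"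
    using d e eq by (simp_all add: ds draws_def)
  then have "s \<in> ?F" "s' \<in> ?F" by simp_all
  then have "s = s'" unfolding t by simp
  then show "d = e" by (simp add: ds)
qed

section \<open>Entropy of queries and information about the index\<close>

lemma log_card_draws:
  "log 2 (card draws) = log 2 (real (\<eta> * k)) + real (k - 1) * log 2 (real n)"
proof -
  have "real (card draws) = real (\<eta> * k) * real n ^ (k - 1)" by (simp add: card_draws)
  moreover have "0 < real (\<eta> * k)" "0 < real n ^ (k - 1)" using n_ge_2 eta_pos k_pos by simp_all
  ultimately show ?thesis using n_ge_2 by (simp only: log_mult_pos log_nat_power)
qed

lemma log_requests: "log 2 (real (\<eta> * k)) = log 2 (real \<eta>) + log 2 (real k)"
  using eta_pos k_pos by (simp add: log_mult_pos)

text \<open>The mean log fibre size is log k; at server 1 the zero seed, of probability 1/n^(k-1),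
  adds log \<eta> to it.\<close>

lemma Hbits_query:
  assumes "l \<in> {1..n}"
  shows "Hbits scheme_pmf (Q l)
    = log 2 \<eta> + real (k - 1) * log 2 n - (if l = 1 then log 2 \<eta> / real n ^ (k - 1) else 0)"
proof -
  have "Hbits scheme_pmf (Q l) = Hbits (pmf_of_set draws) (query_to l)"
    using map_pmf_draw[of "query_to l"] by (intro Hbits_cong_map_pmf) (simp only: Q_eq_query_to[abs_def])
  also have "\<dots> = log 2 (card draws) - (real (\<eta> * k) *
      (real (n ^ (k - 1)) * log 2 k + (if l = 1 then log 2 (real (\<eta> * k)) - log 2 k else 0))) / card draws"
    using sum_draws_fibre[OF assms, of "\<lambda>c. log 2 (real c)"]
    by (simp only: Hbits_pmf_of_set[OF draws_finite draws_nonempty])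
  also have "\<dots> = log 2 (card draws) -
      (log 2 k + (if l = 1 then log 2 \<eta> else 0) / real n ^ (k - 1))"
    using n_ge_2 eta_pos k_pos unfolding log_requests by (simp add: card_draws field_simps)
  finally show ?thesis unfolding log_card_draws log_requests by simp
qed

lemma map_requested: "map_pmf requested scheme_pmf = pmf_of_set {1..\<eta> * k}"
proof -
  have "requested = fst" by (auto simp: requested_def)
  then show ?thesis by (simp add: scheme_pmf_eq map_fst_pair_pmf)
qed

lemma image_requested: "requested ` set_pmf scheme_pmf = {1..\<eta> * k}"
  unfolding pmf.set_map[symmetric] map_requested
  by (rule set_pmf_of_set[OF requests_nonempty finite_atLeastAtMost])

lemma image_Q: "Q l ` set_pmf scheme_pmf = query_to l ` draws"
  using image_draw[of "query_to l"] by (simp add: Q_eq_query_to[abs_def])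

lemma Hbits_requested: "Hbits scheme_pmf requested = log 2 (\<eta> * k)"
proof -
  have "Hbits scheme_pmf requested = Hbits (pmf_of_set {1..\<eta> * k}) (\<lambda>m. m)"
    by (rule Hbits_cong_map_pmf) (simp add: map_requested)
  also have "\<dots> = log 2 (card {1..\<eta> * k})"
    by (rule Hbits_pmf_of_set_inj[OF finite_atLeastAtMost requests_nonempty]) simp
  finally show ?thesis by simp
qed

text \<open>Index and query together determine the draw, so their joint entropy is the log of
  \<open>card draws\<close>, and the seed entropy cancels.\<close>

lemma Ibits_query:
  assumes "l \<in> {1..n}"
  shows "Ibits scheme_pmf requested (Q l) = log 2 \<eta> - (if l = 1 then log 2 \<eta> / real n ^ (k - 1) else 0)"
proof -
  have "Hbits scheme_pmf (\<lambda>\<omega>. (requested \<omega>, Q l \<omega>)) = Hbits (pmf_of_set draws) (\<lambda>d. (fst d, query_to l d))"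
    using map_pmf_draw[of "\<lambda>d. (fst d, query_to l d)"]
    by (intro Hbits_cong_map_pmf) (simp only: Q_eq_query_to[abs_def] fst_draw)
  also have "\<dots> = log 2 (card draws)"
    using inj_on_request_query[OF assms] by (intro Hbits_pmf_of_set_inj) simp_all
  finally have "Hbits scheme_pmf (\<lambda>\<omega>. (requested \<omega>, Q l \<omega>)) = log 2 (card draws)" .
  then show ?thesis
    by (subst Ibits_eq_Hbits)
       (simp_all add: image_requested image_Q Hbits_requested Hbits_query[OF assms] log_card_draws)
qed

text \<open>Given the query, the draw is uniform on the fibre, and there the index determines the
  draw; so the index is uniform on as many values as the fibre has elements.\<close>

lemma Hbits_given_query:
  assumes "d \<in> draws" and "l \<in> {1..n}"
  shows "Hbits_given scheme_pmf requested (Q l) (query_to l d)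
    = log 2 (card {e \<in> draws. query_to l e = query_to l d})"
proof -
  define S where "S = {e. query_to l e = query_to l d}"
  define c where "c = cond_pmf scheme_pmf {\<omega>. Q l \<omega> = query_to l d}"
  have ne: "draws \<inter> S \<noteq> {}" using assms(1) by (auto simp: S_def)
  have vimage: "{\<omega>. Q l \<omega> = query_to l d} = draw -` S"
    by (auto simp: S_def Q_eq_query_to)
  \<comment> \<open>Conditioning may be moved through \<open>draw\<close> because the event has
    positive probability.\<close>
  have "set_pmf scheme_pmf \<inter> draw -` S \<noteq> {}"
  proof -
    have "d \<in> draw ` set_pmf scheme_pmf" using image_draw[of "\<lambda>d. d"] assms(1) by simp
    then obtain \<omega> where "\<omega> \<in> set_pmf scheme_pmf" and "draw \<omega> = d" by (elim imageE) simp
    moreover have "d \<in> S" by (simp add: S_def)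
    ultimately have "\<omega> \<in> set_pmf scheme_pmf \<inter> draw -` S" by simp
    then show ?thesis unfolding ex_in_conv[symmetric] by (rule exI)
  qed
  then have "map_pmf draw c = cond_pmf (pmf_of_set draws) S"
    unfolding c_def vimage map_draw[symmetric] by (rule cond_map_pmf[symmetric])
  also have "\<dots> = pmf_of_set (draws \<inter> S)"
    using ne by (intro cond_pmf_of_set) simp_all
  finally have c: "map_pmf draw c = pmf_of_set (draws \<inter> S)" .
  have "Hbits c requested = Hbits (pmf_of_set (draws \<inter> S)) fst"
    by (rule Hbits_cong_map_pmf) (simp add: c[symmetric] map_pmf_comp fst_draw)
  also have "\<dots> = log 2 (card (draws \<inter> S))"
  proof (rule Hbits_pmf_of_set_inj)
    show "inj_on fst (draws \<inter> S)"
    proof (rule inj_onI)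
      fix e e' assume e: "e \<in> draws \<inter> S" "e' \<in> draws \<inter> S" and fst: "fst e = fst e'"
      have "query_to l e = query_to l d" "query_to l e' = query_to l d"
        using e by (simp_all only: S_def Int_iff mem_Collect_eq)
      then have eq: "(fst e, query_to l e) = (fst e', query_to l e')" by (simp only: fst)
      show "e = e'"
        by (rule inj_onD[OF inj_on_request_query[OF assms(2)] eq]) (use e in simp_all)
    qed
  qed (use ne in simp_all)
  finally show ?thesis unfolding Hbits_given_def c_def S_def by (simp add: Int_def)
qed

lemma Min_Hbits_given:
  assumes "l \<in> {1..n}" and "k \<ge> 2"
  shows "(MIN q\<in>Q l ` set_pmf scheme_pmf. Hbits_given scheme_pmf requested (Q l) q) = log 2 k"
proof -
  have val: "Hbits_given scheme_pmf requested (Q l) (query_to l (m, s))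
      = log 2 (if l = 1 \<and> s = zero_seed then \<eta> * k else k)" if "(m, s) \<in> draws" for m s
    using Hbits_given_query[OF that assms(1)] card_fibre[OF that assms(1)] by simp
  \<comment> \<open>For \<open>k\<close> at least 2 the all-ones seed differs from the zero seed, so
    a fibre of the smaller size occurs even at server 1.\<close>
  define s1 where "s1 = replicate (k - 1) (1::nat)"
  have s1: "(1, s1) \<in> draws" "s1 \<noteq> zero_seed"
    using n_ge_2 eta_pos assms(2) by (auto simp: draws_def seeds_def s1_def Suc_le_eq)
  show ?thesis
    unfolding image_Q
  proof (rule Min_eqI)
    fix y assume "y \<in> Hbits_given scheme_pmf requested (Q l) ` query_to l ` draws"
    then obtain m s where ms: "(m, s) \<in> draws" "y = Hbits_given scheme_pmf requested (Q l) (query_to l (m, s))"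
      by auto
    have "k \<le> \<eta> * k" using eta_pos by simp
    then show "log 2 k \<le> y" unfolding ms(2) val[OF ms(1)] using k_pos
      by (simp only: of_nat_le_iff log_le_cancel_iff[of 2] split: if_splits) (simp del: of_nat_mult)
  next
    have "log 2 k = Hbits_given scheme_pmf requested (Q l) (query_to l (1, s1))"
      unfolding val[OF s1(1)] using s1(2) by simp
    then show "log 2 k \<in> Hbits_given scheme_pmf requested (Q l) ` query_to l ` draws"
      using s1(1) by blast
  qed simp
qed

section \<open>Likelihoods and the number of queries\<close>

lemma cond_prob_query:
  assumes "m \<in> {1..\<eta> * k}"
  shows "\<P>(\<omega> in measure_pmf scheme_pmf. Q l \<omega> = q \<bar> requested \<omega> = m)
    = card {s \<in> seeds. query_to l (m, s) = q} / real n ^ (k - 1)"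
proof -
  have "card {d \<in> draws. query_to l d = q \<and> fst d = m} = card (Pair m ` {s \<in> seeds. query_to l (m, s) = q})"
    using assms by (intro arg_cong[where f = card]) (auto simp: draws_def)
  also have "\<dots> = card {s \<in> seeds. query_to l (m, s) = q}"
    by (rule card_image) (simp add: inj_on_def)
  finally have 1: "card {d \<in> draws. query_to l d = q \<and> fst d = m} = card {s \<in> seeds. query_to l (m, s) = q}" .
  have "{d \<in> draws. fst d = m} = {m} \<times> seeds"
    using assms by (auto simp: draws_def)
  then have 2: "card {d \<in> draws. fst d = m} = n ^ (k - 1)"
    by (simp add: card_cartesian_product card_seeds)
  have "card draws > 0" by (simp add: card_gt_0_iff)
  then show ?thesis
    using prob_draw[of "\<lambda>d. query_to l d = q \<and> fst d = m"] prob_draw[of "\<lambda>d. fst d = m"]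
    unfolding cond_prob_def Q_eq_query_to fst_draw 1 2 by simp
qed

text \<open>A likelihood is 0 or 1/n^(k-1), and the index that produced \<open>q\<close> attains the
  latter. Maximal leakage thus only counts queries.\<close>

lemma Max_cond_prob_query:
  assumes "q \<in> query_to l ` draws" and l: "l \<in> {1..n}"
  shows "(MAX m\<in>{1..\<eta> * k}. \<P>(\<omega> in measure_pmf scheme_pmf. Q l \<omega> = q \<bar> requested \<omega> = m))
    = 1 / real n ^ (k - 1)"
proof -
  obtain m s where m: "m \<in> {1..\<eta> * k}" and s: "s \<in> seeds" and q: "q = query_to l (m, s)"
    using assms(1) by (auto simp: draws_def)
  have val: "\<P>(\<omega> in measure_pmf scheme_pmf. Q l \<omega> = q \<bar> requested \<omega> = m')
      = (if block m' = block m \<or> l = 1 \<and> s = zero_seed then 1 else 0) / real n ^ (k - 1)"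
    if "m' \<in> {1..\<eta> * k}" for m'
    unfolding cond_prob_query[OF that] q card_seeds_query_to_eq[OF m that s l] by simp
  show ?thesis
  proof (rule Max_eqI)
    fix y assume "y \<in> (\<lambda>m. \<P>(\<omega> in measure_pmf scheme_pmf. Q l \<omega> = q \<bar> requested \<omega> = m)) ` {1..\<eta> * k}"
    then obtain m' where "m' \<in> {1..\<eta> * k}"
      "y = \<P>(\<omega> in measure_pmf scheme_pmf. Q l \<omega> = q \<bar> requested \<omega> = m')" by blast
    then show "y \<le> 1 / real n ^ (k - 1)" by (simp add: val)
  next
    show "1 / real n ^ (k - 1)
        \<in> (\<lambda>m. \<P>(\<omega> in measure_pmf scheme_pmf. Q l \<omega> = q \<bar> requested \<omega> = m)) ` {1..\<eta> * k}"
      using val[OF m] m by (intro image_eqI[of _ _ m]) simp_all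
  qed simp
qed

text \<open>Weighting each draw by the reciprocal of its fibre size counts every query once. The
  deficit at server 1 is the merging of \<eta> zero queries into one.\<close>

lemma card_queries:
  assumes "l \<in> {1..n}"
  shows "real (card (query_to l ` draws)) = real \<eta> * real n ^ (k - 1) - (if l = 1 then real \<eta> - 1 else 0)"
proof -
  let ?N = "\<lambda>q. card {e \<in> draws. query_to l e = q}"
  have pos: "?N q > 0" if "q \<in> query_to l ` draws" for q
    using that by (auto simp: card_gt_0_iff)
  have "real (card (query_to l ` draws)) = (\<Sum>q\<in>query_to l ` draws. 1)" by simp
  also have "\<dots> = (\<Sum>q\<in>query_to l ` draws. \<Sum>d\<in>{d\<in>draws. query_to l d = q}. 1 / real (?N (query_to l d)))"
    using pos by (intro sum.cong) auto
  also have "\<dots> = (\<Sum>d\<in>draws. 1 / real (?N (query_to l d)))"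
    by (rule sum.image_gen[symmetric]) simp
  also have "\<dots> = real (\<eta> * k) * (real (n ^ (k - 1)) * (1 / real k)
      + (if l = 1 then 1 / real (\<eta> * k) - 1 / real k else 0))"
    by (rule sum_draws_fibre[OF assms, where f = "\<lambda>c. 1 / real c"])
  also have "\<dots> = real \<eta> * real n ^ (k - 1) - (if l = 1 then real \<eta> - 1 else 0)"
    using eta_pos k_pos by (simp add: field_simps)
  finally show ?thesis .
qed

lemma sum_servers_first:
  fixes a b :: real
  shows "(\<Sum>l=1..n. a - (if l = 1 then b else 0)) = real n * a - b"
  using n_ge_2 by (simp add: sum_subtractf)

lemma leakage_WIL_eq:
  assumes "k \<ge> 2"
  shows "leakage_WIL scheme_pmf n requested Q = log 2 \<eta>"
proof -
  have "Hbits scheme_pmf requested - (MIN q\<in>Q l ` set_pmf scheme_pmf. Hbits_given scheme_pmf requested (Q l) q)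
      = log 2 \<eta>" if "l \<in> {1..n}" for l
    using Min_Hbits_given[OF that assms] Hbits_requested log_requests by simp
  then have "leakage_WIL scheme_pmf n requested Q = (MAX l\<in>{1..n}. log 2 \<eta>)"
    unfolding leakage_WIL_def by (intro arg_cong[where f = Max] image_cong) auto
  then show ?thesis using n_ge_2 by simp
qed

lemma leakage_MaxL_eq: "leakage_MaxL scheme_pmf n requested Q = log 2 \<eta>"
proof -
  let ?K = "real n ^ (k - 1)"
  have K: "?K \<ge> 1" using n_ge_2 by (intro one_le_power) simp
  have val: "(\<Sum>q\<in>Q l ` set_pmf scheme_pmf. MAX m\<in>requested ` set_pmf scheme_pmf.
      \<P>(\<omega> in measure_pmf scheme_pmf. Q l \<omega> = q \<bar> requested \<omega> = m))
      = real \<eta> - (if l = 1 then (real \<eta> - 1) / ?K else 0)" if "l \<in> {1..n}" for l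
  proof -
    have "(\<Sum>q\<in>Q l ` set_pmf scheme_pmf. MAX m\<in>requested ` set_pmf scheme_pmf.
        \<P>(\<omega> in measure_pmf scheme_pmf. Q l \<omega> = q \<bar> requested \<omega> = m))
      = (\<Sum>q\<in>query_to l ` draws. 1 / ?K)"
      unfolding image_Q image_requested using that by (intro sum.cong refl Max_cond_prob_query)
    also have "\<dots> = real (card (query_to l ` draws)) / ?K" by simp
    also have "\<dots> = real \<eta> - (if l = 1 then (real \<eta> - 1) / ?K else 0)"
      unfolding card_queries[OF that] using n_ge_2 by (simp add: diff_divide_distrib)
    finally show ?thesis .
  qed
  \<comment> \<open>The second bound keeps the argument of the logarithm at server 1 at least 1, so
    monotonicity applies.\<close>
  have bounds: "0 \<le> (real \<eta> - 1) / ?K" "(real \<eta> - 1) / ?K \<le> real \<eta> - 1"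
    using eta_pos K by (simp_all add: divide_le_eq mult_left_mono[of 1 ?K "real \<eta> - 1", simplified])
  have "leakage_MaxL scheme_pmf n requested Q
      = (MAX l\<in>{1..n}. log 2 (real \<eta> - (if l = 1 then (real \<eta> - 1) / ?K else 0)))"
    unfolding leakage_MaxL_def by (intro arg_cong[where f = Max] image_cong refl) (simp only: val)
  also have "\<dots> = log 2 \<eta>"
  proof (rule Max_eqI)
    fix y assume "y \<in> (\<lambda>l. log 2 (real \<eta> - (if l = 1 then (real \<eta> - 1) / ?K else 0))) ` {1..n}"
    then show "y \<le> log 2 \<eta>" using bounds eta_pos by (auto split: if_splits)
  next
    \<comment> \<open>Server 2 exists and never receives the zero query, so it attains the
      maximum.\<close>
    show "log 2 \<eta> \<in> (\<lambda>l. log 2 (real \<eta> - (if l = 1 then (real \<eta> - 1) / ?K else 0))) ` {1..n}"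
      using n_ge_2 by (intro image_eqI[of _ _ 2]) auto
  qed simp
  finally show ?thesis .
qed

lemma leakage_MI_eq: "leakage_MI scheme_pmf n requested Q = log 2 \<eta> - log 2 \<eta> / real n ^ k"
proof -
  have "(\<Sum>l=1..n. Ibits scheme_pmf requested (Q l)) = real n * log 2 \<eta> - log 2 \<eta> / real n ^ (k - 1)"
    unfolding sum_servers_first[symmetric] by (intro sum.cong refl Ibits_query)
  moreover have "real n ^ k = real n * real n ^ (k - 1)"
    using k_pos by (metis Suc_diff_1 power_Suc)
  ultimately show ?thesis
    using n_ge_2 unfolding leakage_MI_def by (simp add: field_simps)
qed

lemma upload_cost_eq:
  "upload_cost scheme_pmf n Q
    = real n * ((real k - 1) * log 2 n + log 2 \<eta>) - log 2 \<eta> / real n ^ (k - 1)"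
proof -
  have "upload_cost scheme_pmf n Q
      = real n * (log 2 \<eta> + real (k - 1) * log 2 n) - log 2 \<eta> / real n ^ (k - 1)"
    unfolding upload_cost_def sum_servers_first[symmetric] by (intro sum.cong refl Hbits_query)
  then show ?thesis using k_pos by (simp add: add.commute)
qed

lemma expectation_answer_length:
  assumes "l \<in> {1..n}"
  shows "measure_pmf.expectation scheme_pmf (\<lambda>\<omega>. real (answer_length (Q l \<omega>)))
    = 1 - (if l = 1 then 1 / real n ^ (k - 1) else 0)"
proof -
  have "(\<Sum>d\<in>draws. real (answer_length (query_to l d)))
      = (\<Sum>(m, s)\<in>draws. if l = 1 \<and> s = zero_seed then 0 else 1)"
  proof (intro sum.cong refl)
    fix d assume "d \<in> draws"
    then obtain m s where d: "d = (m, s)" "s \<in> seeds" by (auto simp: draws_def)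
    show "real (answer_length (query_to l d)) = (case d of (m, s) \<Rightarrow> if l = 1 \<and> s = zero_seed then 0 else 1)"
      unfolding answer_length_def d(1) query_to_zero_iff[OF d(2) assms] by simp
  qed
  also have "\<dots> = (\<Sum>m=1..\<eta> * k. \<Sum>s\<in>seeds. if l = 1 \<and> s = zero_seed then 0 else 1)"
    unfolding draws_def by (rule sum.cartesian_product[symmetric])
  also have "\<dots> = real (\<eta> * k) * (real (n ^ (k - 1)) - (if l = 1 then 1 else 0))"
    unfolding sum_seeds_zero_case by simp
  finally have "measure_pmf.expectation scheme_pmf (\<lambda>\<omega>. real (answer_length (Q l \<omega>)))
      = real (\<eta> * k) * (real (n ^ (k - 1)) - (if l = 1 then 1 else 0)) / card draws"
    using expectation_draw[of "\<lambda>d. real (answer_length (query_to l d))"] by (simp only: Q_eq_query_to)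
  then show ?thesis
    using n_ge_2 eta_pos k_pos by (simp add: card_draws diff_divide_distrib)
qed

text \<open>The expected download n - 1/n^(k-1) is n - 1 times the geometric sum, and the file
  length n - 1 cancels.\<close>

lemma rate_eq: "rate scheme_pmf n (n - 1) Q = inverse (\<Sum>i=0..k-1. 1 / real n ^ i)"
proof -
  have "(\<Sum>l=1..n. measure_pmf.expectation scheme_pmf (\<lambda>\<omega>. real (answer_length (Q l \<omega>))))
      = real n * 1 - 1 / real n ^ (k - 1)"
    unfolding sum_servers_first[symmetric] by (intro sum.cong refl expectation_answer_length)
  moreover have "(\<Sum>i=0..k-1. 1 / real n ^ i) = (real n - 1 / real n ^ (k - 1)) / (real n - 1)"
  proof -
    have "(\<Sum>i=0..k-1. 1 / real n ^ i) = (\<Sum>i\<le>k-1. (1 / real n) ^ i)"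
      by (simp add: atLeast0AtMost power_one_over)
    also have "\<dots> = (1 - (1 / real n) ^ Suc (k - 1)) / (1 - 1 / real n)"
      using n_ge_2 by (subst sum_gp0) auto
    also have "(1 / real n) ^ Suc (k - 1) = 1 / real n ^ (k - 1) / real n"
      by (simp add: power_one_over mult.commute)
    also have "(1 - y / real n) / (1 - 1 / real n) = (real n - y) / (real n - 1)" for y
      using n_ge_2 by (simp add: field_simps)
    finally show ?thesis .
  qed
  ultimately show ?thesis
    using n_ge_2 unfolding rate_def by simp
qed

text \<open>The seed entries are the same at all servers, while the balancing symbol takes each
  residue once and hence is nonzero at n - 1 servers.\<close>

lemma sum_accessed_query_to:
  "(\<Sum>l=1..n. real (accessed (query_to l (m, s))))
    = real n * real (length (filter (\<lambda>x. x \<noteq> 0) s)) + (real n - 1)"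
proof -
  let ?nz = "\<lambda>s. length (filter (\<lambda>x::nat. x \<noteq> 0) s)"
  have "?nz (take i s) + ?nz (drop i s) = ?nz s" for i
    by (metis append_take_drop_id filter_append length_append)
  then have "real (accessed (query_to l (m, s))) = real (?nz s) + (if balancing_symbol n s l \<noteq> 0 then 1 else 0)" for l
    unfolding query_to_eq accessed_eq_length_filter schemeA_query_eq embed_def
    by (simp add: of_nat_add[symmetric] del: of_nat_add)
  then have "(\<Sum>l=1..n. real (accessed (query_to l (m, s))))
      = real n * real (?nz s) + (\<Sum>l=1..n. if balancing_symbol n s l \<noteq> 0 then 1 else 0)"
    by (simp add: sum.distrib)
  also have "(\<Sum>l=1..n. if balancing_symbol n s l \<noteq> 0 then 1 else 0 :: real) = (\<Sum>x\<in>{0..<n}. if x \<noteq> 0 then 1 else 0)"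
    using n_ge_2 by (intro sum.reindex_bij_betw bij_betw_balancing_symbol) simp
  also have "\<dots> = real (card ({0..<n} \<inter> {x. x \<noteq> 0}))" by (simp add: sum.If_cases)
  also have "{0..<n} \<inter> {x. x \<noteq> 0} = {1..<n}" by auto
  finally show ?thesis using n_ge_2 by simp
qed

lemma access_complexity_eq: "access_complexity scheme_pmf n Q = (real n - 1) * real k"
proof -
  let ?nz = "\<lambda>s. real (length (filter (\<lambda>x::nat. x \<noteq> 0) s))"
  have "access_complexity scheme_pmf n Q
      = (\<Sum>l=1..n. \<Sum>d\<in>draws. real (accessed (query_to l d))) / card draws"
    using expectation_draw[of "\<lambda>d. real (accessed (query_to l d))" for l]
    unfolding access_complexity_def by (simp only: Q_eq_query_to sum_divide_distrib)
  also have "(\<Sum>l=1..n. \<Sum>d\<in>draws. real (accessed (query_to l d)))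
      = (\<Sum>d\<in>draws. \<Sum>l=1..n. real (accessed (query_to l d)))"
    by (rule sum.swap)
  also have "\<dots> = (\<Sum>(m, s)\<in>draws. real n * ?nz s + (real n - 1))"
    using sum_accessed_query_to by (intro sum.cong) auto
  also have "\<dots> = (\<Sum>m=1..\<eta> * k. \<Sum>s\<in>seeds. real n * ?nz s + (real n - 1))"
    unfolding draws_def by (rule sum.cartesian_product[symmetric])
  also have "\<dots> = real (\<eta> * k) * (real n * (\<Sum>s\<in>seeds. ?nz s) + real n ^ (k - 1) * (real n - 1))"
    by (simp add: sum.distrib sum_distrib_left card_seeds)
  also have "real n * (\<Sum>s\<in>seeds. ?nz s) = real (k - 1) * (real n - 1) * real n ^ (k - 1)"
    unfolding seeds_def using n_ge_2 by (intro sum_nonzero_entries) simp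
  \<comment> \<open>Per draw, the k - 1 seed positions and the requested position each contribute n
    - 1 on average, which gives (n - 1) k.\<close>
  also have "real (\<eta> * k) * (real (k - 1) * (real n - 1) * real n ^ (k - 1) + real n ^ (k - 1) * (real n - 1))
      = (real n - 1) * real k * card draws"
    using k_pos by (simp add: card_draws algebra_simps)
  finally show ?thesis
    using draws_finite draws_nonempty by (simp add: card_gt_0_iff)
qed

section \<open>Retrieval of the requested file\<close>

text \<open>\<open>xs\<close> and \<open>ys\<close> are chosen before \<open>l\<close>: the queries
  to different servers differ in the requested entry alone.\<close>

lemma query_to_split:
  assumes "m \<in> {1..\<eta> * k}" and "s \<in> seeds"
  obtains xs ys where "length xs = m - 1" and "\<And>l. query_to l (m, s) = xs @ balancing_symbol n s l # ys"
proof
  let ?i = "(m - 1) mod k"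
  have "?i \<le> length s"
    using assms(2) k_pos mod_less_divisor[OF k_pos, of "m - 1"] unfolding seeds_def by simp
  then show "length (replicate (block m * k) 0 @ take ?i s) = m - 1"
    by (simp add: block_def min_def)
  show "query_to l (m, s) = (replicate (block m * k) 0 @ take ?i s)
      @ balancing_symbol n s l # drop ?i s @ replicate ((\<eta> - Suc (block m)) * k) 0" for l
    unfolding query_to_eq by (simp add: embed_def schemeA_query_eq)
qed

text \<open>The decoder must return the file as a function on all positions, so the values beyond n
  - 1 matter as well as the dummy at 0.\<close>

lemma stored_dummy:
  assumes "\<omega> \<in> set_pmf scheme_pmf" and "t \<notin> {1..n-1}"
  shows "stored \<omega> i t = 0"
proof -
  have "stored \<omega> \<in> set_pmf (Pi_pmf {1..\<eta> * k} (\<lambda>_. 0) (\<lambda>_. file_pmf (n - 1)))"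
    using assms(1) by (auto simp: scheme_pmf_eq stored_def)
  then have X: "stored \<omega> \<in> PiE_dflt {1..\<eta> * k} (\<lambda>_. 0) (\<lambda>_. set_pmf (file_pmf (n - 1)))"
    by (simp add: set_Pi_pmf o_def)
  have "finite (PiE_dflt {1..n-1} 0 (\<lambda>_. {0, 1::bit}))" "PiE_dflt {1..n-1} 0 (\<lambda>_. {0, 1::bit}) \<noteq> {}"
    by auto
  then have "set_pmf (file_pmf (n - 1)) = PiE_dflt {1..n-1} 0 (\<lambda>_. {0, 1})"
    unfolding file_pmf_def by (rule set_pmf_of_set[rotated])
  then show ?thesis using X assms(2) by (cases "i \<in> {1..\<eta> * k}") (auto simp: PiE_dflt_def)
qed

text \<open>Some server gets the dummy position of the requested file, so its answer is exactly the
  interference that all servers share.\<close>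

lemma retrievable_scheme: "retrievable scheme_pmf n requested stored Q"
proof -
  \<comment> \<open>List positions start at 0, so the value \<open>i\<close> stands for server i +
    1.\<close>
  define server :: "nat \<Rightarrow> query list \<Rightarrow> nat \<Rightarrow> nat" where
    "server m qs a = (SOME i. i < n \<and> qs ! i ! (m - 1) = a)" for m qs a
  \<comment> \<open>Bits add modulo 2, so adding the dummy answer removes the interference from the
    answer containing symbol \<open>t\<close>.\<close>
  define dec :: "nat \<Rightarrow> query list \<Rightarrow> bit list list \<Rightarrow> bitfile" where
    "dec m qs ds t = (if t \<in> {1..n-1}
      then downloaded_symbol (ds ! server m qs t) + downloaded_symbol (ds ! server m qs 0) else 0)" for m qs ds t
  show ?thesis
    unfolding retrievable_def
  proof (intro exI ballI ext)
    fix \<omega> t assume \<omega>: "\<omega> \<in> set_pmf scheme_pmf"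
    define m s X where "m = requested \<omega>" and "s = randomness \<omega>" and "X = stored \<omega>"
    define qs where "qs = map (\<lambda>l. Q l \<omega>) [1..<n+1]"
    define ds where "ds = map (\<lambda>l. download (stored \<omega>) (Q l \<omega>)) [1..<n+1]"
    have "draw \<omega> \<in> draws" using \<omega> image_draw[of "\<lambda>d. d"] by auto
    then have ms: "m \<in> {1..\<eta> * k}" "s \<in> seeds" by (simp_all add: draw_def draws_def m_def s_def)
    have X0: "X i t = 0" if "t \<notin> {1..n-1}" for i t
      using stored_dummy[OF \<omega> that] by (simp add: X_def)
    obtain xs ys where len: "length xs = m - 1"
      and split: "\<And>l. query_to l (m, s) = xs @ balancing_symbol n s l # ys"
      using query_to_split[OF ms] by blast
    have Q: "Q l \<omega> = xs @ balancing_symbol n s l # ys" for l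
      using split by (simp add: Q_eq_query_to draw_def m_def s_def)
    have m: "Suc (length xs) = m" using len ms by simp
    obtain I where I: "answer X (Q l \<omega>) = X m (balancing_symbol n s l) + I" for l
      unfolding Q answer_append_Cons m by blast
    have server: "downloaded_symbol (ds ! server m qs a) = X m a + I" if "a < n" for a
    proof -
      have q: "qs ! i ! (m - 1) = balancing_symbol n s (Suc i)" if "i < n" for i
        using that len by (simp add: qs_def Q nth_append del: upt_Suc)
      have "a \<in> balancing_symbol n s ` {1..n}"
        using bij_betw_imp_surj_on[OF bij_betw_balancing_symbol, of n s] n_ge_2 that by simp
      then obtain l where "l \<in> {1..n}" "balancing_symbol n s l = a" by blast
      then have "l - 1 < n" "Suc (l - 1) = l" by auto
      then have "l - 1 < n \<and> qs ! (l - 1) ! (m - 1) = a"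
        using q[of "l - 1"] \<open>balancing_symbol n s l = a\<close> by metis
      then have j: "server m qs a < n \<and> qs ! server m qs a ! (m - 1) = a"
        unfolding server_def by (rule someI)
      then have "ds ! server m qs a = download X (Q (Suc (server m qs a)) \<omega>)"
        by (simp add: ds_def X_def del: upt_Suc)
      then show ?thesis
        using j q[of "server m qs a"] I[of "Suc (server m qs a)"] X0[of 0]
        by (simp add: downloaded_symbol_download)
    qed
    have "dec m qs ds t = X m t"
    proof (cases "t \<in> {1..n-1}")
      case True
      then have "t < n" "0 < n" by auto
      then show ?thesis
        using True X0[of 0 m] unfolding dec_def server[OF \<open>t < n\<close>] server[OF \<open>0 < n\<close>]
        by (cases I) simp_all
    qed (auto simp: dec_def X0)
    then show "dec (requested \<omega>) (map (\<lambda>l. Q l \<omega>) [1..<n+1])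
        (map (\<lambda>l. download (stored \<omega>) (Q l \<omega>)) [1..<n+1]) t = stored \<omega> (requested \<omega>) t"
      by (simp only: m_def qs_def ds_def X_def)
  qed
qed

end

theorem theorem4:
  fixes n \<mu> \<eta> :: nat
  assumes "n \<ge> 2"
    and "\<eta> \<in> {1..\<mu> - 1}"
    and "\<eta> dvd \<mu>"
  shows "retrievable (partitionA_pmf n \<mu> \<eta>) n requested stored (partitionA_Q n \<mu> \<eta>)
    \<and> rate (partitionA_pmf n \<mu> \<eta>) n (n - 1) (partitionA_Q n \<mu> \<eta>)
           = inverse (\<Sum>i = 0..\<mu> div \<eta> - 1. 1 / real n ^ i)
    \<and> upload_cost (partitionA_pmf n \<mu> \<eta>) n (partitionA_Q n \<mu> \<eta>)
           = real n * ((real \<mu> / real \<eta> - 1) * log 2 (real n) + log 2 (real \<eta>))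
             - log 2 (real \<eta>) / real n ^ (\<mu> div \<eta> - 1)
    \<and> access_complexity (partitionA_pmf n \<mu> \<eta>) n (partitionA_Q n \<mu> \<eta>)
           = (real n - 1) * (real \<mu> / real \<eta>)
    \<and> leakage_MI (partitionA_pmf n \<mu> \<eta>) n requested (partitionA_Q n \<mu> \<eta>)
           = log 2 (real \<eta>) - log 2 (real \<eta>) / real n ^ (\<mu> div \<eta>)
    \<and> leakage_WIL (partitionA_pmf n \<mu> \<eta>) n requested (partitionA_Q n \<mu> \<eta>) = log 2 (real \<eta>)
    \<and> leakage_MaxL (partitionA_pmf n \<mu> \<eta>) n requested (partitionA_Q n \<mu> \<eta>) = log 2 (real \<eta>)"
proof -
  obtain k where \<mu>: "\<mu> = \<eta> * k" using assms(3) by (elim dvdE)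
  have "\<eta> > 0" "\<eta> < \<mu>" using assms(2) by auto
  \<comment> \<open>\<open>\<eta> < \<mu>\<close> excludes one-file partitions, for which server 1
    would always receive the zero query.\<close>
  then have \<eta>: "\<eta> > 0" and k: "k \<ge> 2" by (simp_all add: \<mu>)
  interpret partition_scheme n k \<eta>
    using assms(1) \<eta> k by unfold_locales auto
  have "\<mu> div \<eta> = k" "real \<mu> / real \<eta> = real k" using \<eta> by (simp_all add: \<mu>)
  then show ?thesis
    using retrievable_scheme rate_eq upload_cost_eq access_complexity_eq leakage_MI_eq
      leakage_WIL_eq[OF k] leakage_MaxL_eq
    by (simp only: \<mu>[symmetric])
qed

end
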